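(* Let $\tau>0$ and let $U_h$, $H_h=H^F_h\times H^Z_h\times H^w_h$ be the finite element spaces defined in the context, for an arbitrary triangulation $\mathcal{T}_h$ of $\mathbb{T}^3$ and an arbitrary integer $k\ge 1$. Suppose that $(v^{n-1}_h,\xi^{n-1}_h)\in U_h\times H_h$ and that $(v^n_h,\xi^n_h)\in U_h\times H_h$ solves the fully-discrete scheme $$\Bigl(\frac{v^n_h-v^{n-1}_h}{\tau},\varphi_h\Bigr)=-\bigl(DG(\xi^n_h),\,D\Phi(F^{n-1}_h)\nabla\varphi_h\bigr)\quad\text{for all }\varphi_h\in U_h,$$ $$\Bigl(\frac{\xi^n_h-\xi^{n-1}_h}{\tau},\psi_h\Bigr)=\bigl(D\Phi(F^{n-1}_h)\nabla v^n_h,\,\psi_h\bigr)\quad\text{for all }\psi_h\in H_h,$$ where $\xi^{n-1}_h=(F^{n-1}_h,Z^{n-1}_h,w^{n-1}_h)$. Then $$\tfrac12\|v^n_h\|^2_{L^2(\mathbb{T}^3)}+\tfrac12\|v^n_h-v^{n-1}_h\|^2_{L^2(\mathbb{T}^3)}+\int_{\mathbb{T}^3}G(\xi^n_h)\,dx\;\le\;\tfrac12\|v^{n-1}_h\|^2_{L^2(\mathbb{T}^3)}+\int_{\mathbb{T}^3}G(\xi^{n-1}_h)\,dx .$$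
   Context: $\mathbb{T}^3$ is the three-dimensional torus; $M^{3\times3}$ is the space of real $3\times 3$ matrices. Indices $i,j,k,\alpha,\beta,\gamma$ (as tensor indices) run over $1,2,3$ and $A,B$ over $1,\dots,19$; repeated indices are summed. $\Phi:M^{3\times3}\to\mathbb{R}^{19}$, $\Phi(F)=(F,\mathrm{cof}\,F,\det F)$, where $(\mathrm{cof}\,F)_{i\alpha}=\tfrac12\varepsilon_{ijk}\varepsilon_{\alpha\beta\gamma}F_{j\beta}F_{k\gamma}$; $\Phi^A$ are its components. $(\cdot,\cdot)$ is the $L^2(\mathbb{T}^3)$ inner product (of vector-valued functions), $DG=(\partial G/\partial\xi_A)_{A}$, and $D\Phi(F)\nabla\varphi$ is the $\mathbb{R}^{19}$-valued function with components $\frac{\partial\Phi^A}{\partial F_{i\alpha}}(F)\,\partial_\alpha\varphi_i$. Assumptions on $G$: $G=G(\xi)=G(F,Z,w):M^{3\times3}\times M^{3\times3}\times\mathbb{R}\cong\mathbb{R}^{19}\to[0,\infty)$ is $C^3$, uniformly convex, and, for some $p\in(6,\infty)$ and positive constants $\kappa,\kappa',\gamma,\gamma',c_1,\dots,c_8$: - $G(\xi)=H(F)+R(\xi)$ with $H\in C^3(M^{3\times3};[0,\infty))$ and $R\in C^3(\mathbb{R}^{19};[0,\infty))$ strictly convex, $\kappa|F|^{p-2}|z|^2\le z^T\nabla^2H(F)z\le\kappa'|F|^{p-2}|z|^2$ for all $z\in\mathbb{R}^9$, and $\gamma I\le\nabla^2R\le\gamma' I$; - $G(\xi)\ge c_1|F|^p+c_2|Z|^2+c_3|w|^2-c_4$;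 - $G(\xi)\le c_5(|F|^p+|Z|^2+|w|^2+1)$; - $|G_F|^{p/(p-1)}+|G_Z|^{p/(p-2)}+|G_w|^{p/(p-3)}\le c_6(|F|^p+|Z|^2+|w|^2+1)$; - $|\partial^3H/\partial F_{i\alpha}\partial F_{ml}\partial F_{rs}|\le c_7|F|^{p-3}$ and $|\partial^3R/\partial\xi_A\partial\xi_B\partial\xi_D|\le c_8$. Finite element spaces: $\mathcal{T}_h=\mathcal{T}_h(\mathbb{T}^3)$ is a (finite, conforming, simplicial) triangulation of $\mathbb{T}^3$ with elements $K$, $\mathcal{P}_m(K)$ is the space of polynomials on $K$ of total degree at most $m$, and $U_h=\{\varphi\in C(\mathbb{T}^3;\mathbb{R}^3):\varphi|_K\in[\mathcal{P}_k(K)]^3\ \forall K\in\mathcal{T}_h\}$, $H^F_h=\{A\in L^2(\mathbb{T}^3;M^{3\times3}):A|_K\in[\mathcal{P}_{k-1}(K)]^9\ \forall K\}$, $H^Z_h=\{B\in L^2(\mathbb{T}^3;M^{3\times3}):B|_K\in[\mathcal{P}_{2(k-1)}(K)]^9\ \forall K\}$, $H^w_h=\{d\in L^2(\mathbb{T}^3):d|_K\in\mathcal{P}_{3(k-1)}(K)\ \forall K\}$. *)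

theory Defs
  imports "HOL-Analysis.Analysis"
begin

section \<open>Derivatives\<close>

definition dderiv :: "('a::euclidean_space \<Rightarrow> real) \<Rightarrow> 'a \<Rightarrow> 'a \<Rightarrow> real" where
  "dderiv f b x = frechet_derivative f (at x) b"

text \<open>\<open>Ck n f\<close>: \<open>f\<close> is \<open>n\<close> times continuously differentiable on the whole space.\<close>

primrec Ck :: "nat \<Rightarrow> ('a::euclidean_space \<Rightarrow> real) \<Rightarrow> bool" where
  "Ck 0 f \<longleftrightarrow> continuous_on UNIV f"
| "Ck (Suc n) f \<longleftrightarrow> (\<forall>x. f differentiable (at x)) \<and> (\<forall>b. Ck n (dderiv f b))"

definition grad :: "('a::euclidean_space \<Rightarrow> real) \<Rightarrow> 'a \<Rightarrow> 'a" where
  "grad f x = (\<Sum>b\<in>Basis. dderiv f b x *\<^sub>R b)"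

text \<open>\<open>hess_form f x z\<close> is \<open>z\<^sup>T \<nabla>\<^sup>2f(x) z\<close>.\<close>

definition hess_form :: "('a::euclidean_space \<Rightarrow> real) \<Rightarrow> 'a \<Rightarrow> 'a \<Rightarrow> real" where
  "hess_form f x z =
     (\<Sum>a\<in>Basis. \<Sum>b\<in>Basis. dderiv (dderiv f a) b x * (z \<bullet> a) * (z \<bullet> b))"

definition strictly_convex :: "('a::real_vector \<Rightarrow> real) \<Rightarrow> bool" where
  "strictly_convex f \<longleftrightarrow>
     (\<forall>x y t. x \<noteq> y \<and> 0 < t \<and> t < 1 \<longrightarrow>
        f ((1 - t) *\<^sub>R x + t *\<^sub>R y) < (1 - t) * f x + t * f y)"

text \<open>Uniform convexity of a \<open>C\<^sup>2\<close> function: the Hessian is bounded below by a positive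
  multiple of the identity.\<close>

definition uniformly_convex :: "('a::euclidean_space \<Rightarrow> real) \<Rightarrow> bool" where
  "uniformly_convex f \<longleftrightarrow> (\<exists>\<theta>>0. \<forall>x z. \<theta> * (norm z)\<^sup>2 \<le> hess_form f x z)"


section \<open>The null Lagrangians and the stored energy\<close>

type_synonym mat3 = "real^3^3"
type_synonym xi_space = "mat3 \<times> mat3 \<times> real"

definition levi_civita :: "3 \<Rightarrow> 3 \<Rightarrow> 3 \<Rightarrow> real" where
  "levi_civita i j k =
     (if (i, j, k) \<in> {(1, 2, 3), (2, 3, 1), (3, 1, 2)} then 1
      else if (i, j, k) \<in> {(3, 2, 1), (1, 3, 2), (2, 1, 3)} then - 1
      else 0)"

definition cof :: "mat3 \<Rightarrow> mat3" where
  "cof F = (\<chi> i \<alpha>. 1/2 * (\<Sum>j\<in>UNIV. \<Sum>k\<in>UNIV. \<Sum>\<beta>\<in>UNIV. \<Sum>\<gamma>\<in>UNIV.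
      levi_civita i j k * levi_civita \<alpha> \<beta> \<gamma> * F $ j $ \<beta> * F $ k $ \<gamma>))"

definition Phi :: "mat3 \<Rightarrow> xi_space" where
  "Phi F = (F, cof F, det F)"

text \<open>The norms of \<^typ>\<open>mat3\<close> and \<^typ>\<open>xi_space\<close> are the Euclidean norms of
  \<open>\<real>\<^sup>9\<close> and \<open>\<real>\<^sup>1\<^sup>9\<close>, and their \<^const>\<open>Basis\<close> elements are the coordinate directions.\<close>

definition admissible_energy :: "(xi_space \<Rightarrow> real) \<Rightarrow> bool" where
  "admissible_energy G \<longleftrightarrow>
     (\<forall>\<xi>. 0 \<le> G \<xi>) \<and> Ck 3 G \<and> uniformly_convex G \<and>
     (\<exists>p \<kappa> \<kappa>' \<gamma> \<gamma>' c1 c2 c3 c4 c5 c6 c7 c8 :: real.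
      \<exists>(H :: mat3 \<Rightarrow> real) (R :: xi_space \<Rightarrow> real).
        6 < p \<and> 0 < \<kappa> \<and> 0 < \<kappa>' \<and> 0 < \<gamma> \<and> 0 < \<gamma>' \<and>
        0 < c1 \<and> 0 < c2 \<and> 0 < c3 \<and> 0 < c4 \<and> 0 < c5 \<and> 0 < c6 \<and> 0 < c7 \<and> 0 < c8 \<and>
        (\<forall>F Z w. G (F, Z, w) = H F + R (F, Z, w)) \<and>
        (\<forall>F. 0 \<le> H F) \<and> Ck 3 H \<and>
        (\<forall>\<xi>. 0 \<le> R \<xi>) \<and> Ck 3 R \<and> strictly_convex R \<and>
        (\<forall>F z. \<kappa> * norm F powr (p - 2) * (norm z)\<^sup>2 \<le> hess_form H F z \<and>
               hess_form H F z \<le> \<kappa>' * norm F powr (p - 2) * (norm z)\<^sup>2) \<and>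
        (\<forall>\<xi> z. \<gamma> * (norm z)\<^sup>2 \<le> hess_form R \<xi> z \<and> hess_form R \<xi> z \<le> \<gamma>' * (norm z)\<^sup>2) \<and>
        (\<forall>F Z w. c1 * norm F powr p + c2 * (norm Z)\<^sup>2 + c3 * \<bar>w\<bar>\<^sup>2 - c4 \<le> G (F, Z, w)) \<and>
        (\<forall>F Z w. G (F, Z, w) \<le> c5 * (norm F powr p + (norm Z)\<^sup>2 + \<bar>w\<bar>\<^sup>2 + 1)) \<and>
        (\<forall>F Z w. (let (G_F, G_Z, G_w) = grad G (F, Z, w) in
             norm G_F powr (p / (p - 1)) + norm G_Z powr (p / (p - 2)) + \<bar>G_w\<bar> powr (p / (p - 3))
             \<le> c6 * (norm F powr p + (norm Z)\<^sup>2 + \<bar>w\<bar>\<^sup>2 + 1))) \<and>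
        (\<forall>F. \<forall>a\<in>Basis. \<forall>b\<in>Basis. \<forall>d\<in>Basis.
             \<bar>dderiv (dderiv (dderiv H a) b) d F\<bar> \<le> c7 * norm F powr (p - 3)) \<and>
        (\<forall>\<xi>. \<forall>a\<in>Basis. \<forall>b\<in>Basis. \<forall>d\<in>Basis.
             \<bar>dderiv (dderiv (dderiv R a) b) d \<xi>\<bar> \<le> c8))"


section \<open>The torus\<close>

text \<open>The torus is \<open>\<real>\<^sup>3/\<int>\<^sup>3\<close>. Functions on it are represented by their \<open>\<int>\<^sup>3\<close>-periodic lifts
  to \<open>\<real>\<^sup>3\<close>, and integrals over it by Lebesgue integrals over the unit cell.\<close>

definition int_lattice :: "(real^3) set" where
  "int_lattice = {a. \<forall>i. a $ i \<in> \<int>}"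

definition periodic :: "(real^3 \<Rightarrow> 'b) \<Rightarrow> bool" where
  "periodic f \<longleftrightarrow> (\<forall>a\<in>int_lattice. \<forall>x. f (x + a) = f x)"

definition torus :: "(real^3) measure" where
  "torus = lebesgue_on (cbox 0 1)"

definition L2_space :: "(real^3 \<Rightarrow> 'b::euclidean_space) set" where
  "L2_space = {f. periodic f \<and> f \<in> borel_measurable torus \<and> integrable torus (\<lambda>x. (norm (f x))\<^sup>2)}"

definition L2_inner :: "(real^3 \<Rightarrow> 'b::euclidean_space) \<Rightarrow> (real^3 \<Rightarrow> 'b) \<Rightarrow> real" where
  "L2_inner f g = (\<integral>x. f x \<bullet> g x \<partial>torus)"

definition L2_norm :: "(real^3 \<Rightarrow> 'b::euclidean_space) \<Rightarrow> real" where
  "L2_norm f = sqrt (L2_inner f f)"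


section \<open>Finite element spaces\<close>

text \<open>A triangulation of the torus is represented by its lift to \<open>\<real>\<^sup>3\<close>, that is, by the
  \<open>\<int>\<^sup>3\<close>-invariant set of all closed tetrahedra that are lifts of elements. There are finitely many
  elements if and only if finitely many of these tetrahedra meet the unit cell. Since
  \<^term>\<open>{} face_of S\<close> holds for every \<open>S\<close>, the last condition is conformity. Coarse periodic meshes, whose
  closed elements are not embedded in the torus, are allowed.\<close>

definition torus_triangulation :: "(real^3) set set \<Rightarrow> bool" where
  "torus_triangulation \<T> \<longleftrightarrow>
     (\<forall>K\<in>\<T>. 3 simplex K) \<and>
     (\<forall>K\<in>\<T>. \<forall>a\<in>int_lattice. (+) a ` K \<in> \<T>) \<and>
     finite {K\<in>\<T>. K \<inter> cbox 0 1 \<noteq> {}} \<and>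
     \<Union>\<T> = UNIV \<and>
     (\<forall>K\<in>\<T>. \<forall>K'\<in>\<T>. (K \<inter> K') face_of K \<and> (K \<inter> K') face_of K')"

text \<open>Polynomials of total degree at most \<open>m\<close> with coefficients in \<open>'b\<close>; the sum ranges over
  multi-indices.\<close>

definition poly_space :: "nat \<Rightarrow> (real^3 \<Rightarrow> 'b::euclidean_space) set" where
  "poly_space m = {q. \<exists>c :: (3 \<Rightarrow> nat) \<Rightarrow> 'b.
     \<forall>x. q x = (\<Sum>\<alpha> | sum \<alpha> UNIV \<le> m. (\<Prod>i\<in>UNIV. x $ i ^ \<alpha> i) *\<^sub>R c \<alpha>)}"

definition U_space :: "(real^3) set set \<Rightarrow> nat \<Rightarrow> (real^3 \<Rightarrow> real^3) set" where
  "U_space \<T> k = {\<phi>. periodic \<phi> \<and> continuous_on UNIV \<phi> \<and>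
     (\<forall>K\<in>\<T>. \<exists>q\<in>poly_space k. \<forall>x\<in>K. \<phi> x = q x)}"

text \<open>Elements of \<open>L\<^sup>2\<close> are only determined almost everywhere, in particular not on the faces
  shared by neighbouring elements.\<close>

definition dg_space :: "(real^3) set set \<Rightarrow> nat \<Rightarrow> (real^3 \<Rightarrow> 'b::euclidean_space) set" where
  "dg_space \<T> m = {f \<in> L2_space.
     \<forall>K\<in>\<T>. \<exists>q\<in>poly_space m. AE x in lebesgue_on K. f x = q x}"

definition HF_space :: "(real^3) set set \<Rightarrow> nat \<Rightarrow> (real^3 \<Rightarrow> mat3) set" where
  "HF_space \<T> k = dg_space \<T> (k - 1)"

definition HZ_space :: "(real^3) set set \<Rightarrow> nat \<Rightarrow> (real^3 \<Rightarrow> mat3) set" where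
  "HZ_space \<T> k = dg_space \<T> (2 * (k - 1))"

definition Hw_space :: "(real^3) set set \<Rightarrow> nat \<Rightarrow> (real^3 \<Rightarrow> real) set" where
  "Hw_space \<T> k = dg_space \<T> (3 * (k - 1))"

definition H_space :: "(real^3) set set \<Rightarrow> nat \<Rightarrow> (real^3 \<Rightarrow> xi_space) set" where
  "H_space \<T> k = {\<lambda>x. (F x, Z x, w x) | F Z w.
     F \<in> HF_space \<T> k \<and> Z \<in> HZ_space \<T> k \<and> w \<in> Hw_space \<T> k}"


section \<open>The fully discrete scheme\<close>

text \<open>\<open>D\<Phi>(F)\<nabla>\<phi>\<close>. The matrix \<^term>\<open>jacobian \<phi> (at x)\<close> has the entries \<open>\<partial>\<^sub>\<alpha>\<phi>\<^sub>i(x)\<close>. Functions in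
  \<^const>\<open>U_space\<close> are differentiable in the interior of every element, hence almost everywhere,
  and this gradient is their weak gradient.\<close>

definition DPhi_grad :: "(real^3 \<Rightarrow> mat3) \<Rightarrow> (real^3 \<Rightarrow> real^3) \<Rightarrow> real^3 \<Rightarrow> xi_space" where
  "DPhi_grad F \<phi> x = frechet_derivative Phi (at (F x)) (jacobian \<phi> (at x))"

definition solves_scheme ::
  "(xi_space \<Rightarrow> real) \<Rightarrow> (real^3) set set \<Rightarrow> nat \<Rightarrow> real \<Rightarrow>
   (real^3 \<Rightarrow> real^3) \<Rightarrow> (real^3 \<Rightarrow> xi_space) \<Rightarrow> (real^3 \<Rightarrow> real^3) \<Rightarrow> (real^3 \<Rightarrow> xi_space) \<Rightarrow> bool" where
  "solves_scheme G \<T> k \<tau> v0 \<xi>0 v1 \<xi>1 \<longleftrightarrow>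
     (\<forall>\<phi>\<in>U_space \<T> k.
        L2_inner (\<lambda>x. (v1 x - v0 x) /\<^sub>R \<tau>) \<phi> =
        - L2_inner (\<lambda>x. grad G (\<xi>1 x)) (DPhi_grad (\<lambda>x. fst (\<xi>0 x)) \<phi>)) \<and>
     (\<forall>\<psi>\<in>H_space \<T> k.
        L2_inner (\<lambda>x. (\<xi>1 x - \<xi>0 x) /\<^sub>R \<tau>) \<psi> =
        L2_inner (DPhi_grad (\<lambda>x. fst (\<xi>0 x)) v1) \<psi>)"

end

(* The polynomial degrees of the spaces are chosen so that DPhi(F0) grad v1 lies in H_h. The second
   equation, tested with its own residual, therefore holds almost everywhere. Testing the first
   equation with v1 then gives (v1 - v0, v1) = -(DG(xi1), xi1 - xi0), whose right-hand side is at most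
   the integral of G(xi0) - G(xi1) by convexity of G, and
   (v1 - v0) . v1 = |v1|^2/2 + |v1 - v0|^2/2 - |v0|^2/2.
   All functions involved are essentially bounded, as polynomials on finitely many compact
   elements, so every integral converges. *)
theory Submission
  imports Defs
begin

section \<open>Polynomials\<close>

text \<open>Every exponent is at most the total degree. Finiteness matters because a sum over an
  infinite set is 0 by default, which would make \<open>poly_space\<close> trivial.\<close>

lemma finite_multi_indices: "finite {\<alpha> :: 'n::finite \<Rightarrow> nat. sum \<alpha> UNIV \<le> m}"
proof (rule finite_subset)
  show "{\<alpha> :: 'n \<Rightarrow> nat. sum \<alpha> UNIV \<le> m} \<subseteq> PiE UNIV (\<lambda>_. {..m})"
    by (auto intro: order_trans[OF member_le_sum[of _ UNIV]])
qed (simp add: finite_PiE)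

lemma poly_spaceE:
  assumes "q \<in> poly_space m"
  obtains c where "q = (\<lambda>x. \<Sum>\<alpha> | sum \<alpha> UNIV \<le> m. (\<Prod>i\<in>UNIV. x $ i ^ \<alpha> i) *\<^sub>R c \<alpha>)"
  using assms by (auto simp: poly_space_def)

lemma poly_space_monomial:
  assumes "sum \<alpha> UNIV \<le> m"
  shows "(\<lambda>x. (\<Prod>i\<in>UNIV. x $ i ^ \<alpha> i) *\<^sub>R c) \<in> poly_space m"
proof -
  have "(\<Sum>\<beta> | sum \<beta> UNIV \<le> m. (\<Prod>i\<in>UNIV. x $ i ^ \<beta> i) *\<^sub>R (if \<beta> = \<alpha> then c else 0))
      = (\<Prod>i\<in>UNIV. x $ i ^ \<alpha> i) *\<^sub>R c" for x :: "real^3"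
    using assms by (subst sum.remove[of _ \<alpha>]) (auto simp: finite_multi_indices intro!: sum.neutral)
  then show ?thesis
    unfolding poly_space_def by (auto intro!: exI[of _ "\<lambda>\<beta>. if \<beta> = \<alpha> then c else 0"])
qed

lemma poly_space_add:
  assumes "p \<in> poly_space m" "q \<in> poly_space m"
  shows "(\<lambda>x. p x + q x) \<in> poly_space m"
proof -
  obtain c where c: "p = (\<lambda>x. \<Sum>\<alpha> | sum \<alpha> UNIV \<le> m. (\<Prod>i\<in>UNIV. x $ i ^ \<alpha> i) *\<^sub>R c \<alpha>)"
    using assms(1) by (rule poly_spaceE)
  obtain d where d: "q = (\<lambda>x. \<Sum>\<alpha> | sum \<alpha> UNIV \<le> m. (\<Prod>i\<in>UNIV. x $ i ^ \<alpha> i) *\<^sub>R d \<alpha>)"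
    using assms(2) by (rule poly_spaceE)
  show ?thesis
    unfolding c d poly_space_def
    by (auto intro!: exI[of _ "\<lambda>\<alpha>. c \<alpha> + d \<alpha>"] simp: scaleR_right_distrib sum.distrib)
qed

lemma poly_space_sum:
  assumes "\<And>i. i \<in> I \<Longrightarrow> q i \<in> poly_space m"
  shows "(\<lambda>x. \<Sum>i\<in>I. q i x) \<in> poly_space m"
  using assms
proof (induction I rule: infinite_finite_induct)
  case (insert i I)
  then show ?case by (simp add: poly_space_add)
\<comment> \<open>The empty and the infinite index set both give the zero function, that is, the
  constant monomial with coefficient 0.\<close>
qed (use poly_space_monomial[of "\<lambda>_. 0" m 0] in simp_all)

lemma poly_space_bounded_linear:
  assumes "q \<in> poly_space m" "bounded_linear L"
  shows "(\<lambda>x. L (q x)) \<in> poly_space m"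
proof -
  interpret bounded_linear L by fact
  obtain c where "q = (\<lambda>x. \<Sum>\<alpha> | sum \<alpha> UNIV \<le> m. (\<Prod>i\<in>UNIV. x $ i ^ \<alpha> i) *\<^sub>R c \<alpha>)"
    using assms(1) by (rule poly_spaceE)
  then show ?thesis
    unfolding poly_space_def by (auto intro!: exI[of _ "\<lambda>\<alpha>. L (c \<alpha>)"] simp: sum scaleR)
qed

text \<open>Expanding both sums by bilinearity, exponents add monomial by monomial. Used with
  \<open>cof_polar\<close> and the inner product, this controls the degrees of the components of
  \<open>DPhi\<close>.\<close>

lemma poly_space_bounded_bilinear:
  assumes "p \<in> poly_space m" "q \<in> poly_space n" "bounded_bilinear b"
  shows "(\<lambda>x. b (p x) (q x)) \<in> poly_space (m + n)"
proof -
  interpret bounded_bilinear b by fact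
  obtain c where c: "p = (\<lambda>x. \<Sum>\<alpha> | sum \<alpha> UNIV \<le> m. (\<Prod>i\<in>UNIV. x $ i ^ \<alpha> i) *\<^sub>R c \<alpha>)"
    using assms(1) by (rule poly_spaceE)
  obtain d where d: "q = (\<lambda>x. \<Sum>\<alpha> | sum \<alpha> UNIV \<le> n. (\<Prod>i\<in>UNIV. x $ i ^ \<alpha> i) *\<^sub>R d \<alpha>)"
    using assms(2) by (rule poly_spaceE)
  have "(\<lambda>x. b (p x) (q x)) =
      (\<lambda>x. \<Sum>\<alpha> | sum \<alpha> UNIV \<le> m. \<Sum>\<beta> | sum \<beta> UNIV \<le> n.
        (\<Prod>i\<in>UNIV. x $ i ^ (\<alpha> i + \<beta> i)) *\<^sub>R b (c \<alpha>) (d \<beta>))"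
    unfolding c d sum_left by (simp add: sum_right scaleR_left scaleR_right power_add prod.distrib mult.commute)
  also have "\<dots> \<in> poly_space (m + n)"
    by (intro poly_space_sum poly_space_monomial) (simp add: sum.distrib add_mono)
  finally show ?thesis .
qed

text \<open>The witnesses \<open>q' i\<close> are the partial derivatives, obtained monomial by
  monomial from the product rule.\<close>

lemma poly_space_has_derivative:
  assumes "q \<in> poly_space m"
  obtains q' where "\<And>i. q' i \<in> poly_space (m - 1)"
    and "\<And>x. (q has_derivative (\<lambda>h. \<Sum>i\<in>UNIV. h $ i *\<^sub>R q' i x)) (at x)"
proof -
  obtain c where c: "q = (\<lambda>x. \<Sum>\<alpha> | sum \<alpha> UNIV \<le> m. (\<Prod>i\<in>UNIV. x $ i ^ \<alpha> i) *\<^sub>R c \<alpha>)"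
    using assms by (rule poly_spaceE)
  define q' where "q' i x = (\<Sum>\<alpha> | sum \<alpha> UNIV \<le> m.
      (\<Prod>j\<in>UNIV. x $ j ^ (\<alpha>(i := \<alpha> i - 1)) j) *\<^sub>R (real (\<alpha> i) *\<^sub>R c \<alpha>))" for i and x :: "real^3"
  show thesis
  proof
    show "q' i \<in> poly_space (m - 1)" for i
      unfolding q'_def[abs_def]
    proof (rule poly_space_sum)
      fix \<alpha> :: "3 \<Rightarrow> nat" assume \<alpha>: "\<alpha> \<in> {\<alpha>. sum \<alpha> UNIV \<le> m}"
      show "(\<lambda>x. (\<Prod>j\<in>UNIV. x $ j ^ (\<alpha>(i := \<alpha> i - 1)) j) *\<^sub>R (real (\<alpha> i) *\<^sub>R c \<alpha>))
          \<in> poly_space (m - 1)"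
      \<comment> \<open>If \<alpha> i = 0, the truncated \<alpha> i - 1 does not lower the degree,
        but the factor \<open>real (\<alpha> i)\<close> kills the term. Otherwise the degree really
        drops by one.\<close>
      proof (cases "\<alpha> i = 0")
        case True
        then show ?thesis
          using poly_space_monomial[of "\<lambda>_. 0" "m - 1" 0] by simp
      next
        case False
        have "sum (\<alpha>(i := \<alpha> i - 1)) (UNIV - {i}) = sum \<alpha> (UNIV - {i})"
          by (intro sum.cong) auto
        then have "sum (\<alpha>(i := \<alpha> i - 1)) UNIV \<le> m - 1"
          using \<alpha> False by (simp add: sum.remove[of UNIV i])
        then show ?thesis by (rule poly_space_monomial)
      qed
    qed
    fix x :: "real^3"
    have "((\<lambda>x. (\<Prod>i\<in>UNIV. x $ i ^ \<alpha> i) *\<^sub>R c \<alpha>) has_derivative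
        (\<lambda>h. \<Sum>i\<in>UNIV. h $ i *\<^sub>R ((\<Prod>j\<in>UNIV. x $ j ^ (\<alpha>(i := \<alpha> i - 1)) j) *\<^sub>R (real (\<alpha> i) *\<^sub>R c \<alpha>))))
        (at x)" for \<alpha> :: "3 \<Rightarrow> nat"
    proof -
      \<comment> \<open>The lowered exponent occurs only in the i-th factor. Isolating it matches
        the form in which the product rule for finite products arrives.\<close>
      have split: "(\<Prod>j\<in>UNIV. x $ j ^ (\<alpha>(i := \<alpha> i - 1)) j)
          = x $ i ^ (\<alpha> i - 1) * (\<Prod>j\<in>UNIV - {i}. x $ j ^ \<alpha> j)" for i
        by (subst prod.remove[of UNIV i]) auto
      have "((\<lambda>x. x $ i ^ \<alpha> i) has_derivative (\<lambda>h. h $ i * (real (\<alpha> i) * x $ i ^ (\<alpha> i - 1)))) (at x)" for i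
        by (auto intro!: derivative_eq_intros bounded_linear_imp_has_derivative bounded_linear_vec_nth)
      then have "((\<lambda>x. \<Prod>i\<in>UNIV. x $ i ^ \<alpha> i) has_derivative
          (\<lambda>h. \<Sum>i\<in>UNIV. h $ i * (real (\<alpha> i) * x $ i ^ (\<alpha> i - 1)) * (\<Prod>j\<in>UNIV - {i}. x $ j ^ \<alpha> j))) (at x)"
        by (intro has_derivative_prod)
      then show ?thesis
        unfolding split
        by (rule has_derivative_eq_rhs[OF has_derivative_scaleR_left])
          (simp add: fun_eq_iff scaleR_sum_left mult_ac)
    qed
    then have "(q has_derivative (\<lambda>h. \<Sum>\<alpha> | sum \<alpha> UNIV \<le> m. \<Sum>i\<in>UNIV.
        h $ i *\<^sub>R ((\<Prod>j\<in>UNIV. x $ j ^ (\<alpha>(i := \<alpha> i - 1)) j) *\<^sub>R (real (\<alpha> i) *\<^sub>R c \<alpha>)))) (at x)"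
      unfolding c by (intro has_derivative_sum)
    then show "(q has_derivative (\<lambda>h. \<Sum>i\<in>UNIV. h $ i *\<^sub>R q' i x)) (at x)"
      unfolding q'_def scaleR_sum_right by (subst sum.swap)
  qed
qed

lemma continuous_on_poly_space: "q \<in> poly_space m \<Longrightarrow> continuous_on S q"
  by (erule poly_spaceE) (auto intro!: continuous_intros)

lemma jacobian_poly_space:
  fixes q :: "real^3 \<Rightarrow> real^3"
  assumes "q \<in> poly_space m"
  shows "(\<lambda>x. jacobian q (at x)) \<in> poly_space (m - 1)"
proof -
  obtain q' where q': "\<And>i. q' i \<in> poly_space (m - 1)"
    and der: "\<And>x. (q has_derivative (\<lambda>h. \<Sum>i\<in>UNIV. h $ i *\<^sub>R q' i x)) (at x)"
    using assms by (rule poly_space_has_derivative) blast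
  \<comment> \<open>\<open>L s y\<close> is the matrix with s-th column \<open>y\<close> and zeros
    elsewhere, so the Jacobian is the sum of its columns \<open>L s (q' s x)\<close>, each linear in
    a partial derivative.\<close>
  define L :: "3 \<Rightarrow> real^3 \<Rightarrow> mat3" where "L s y = (\<chi> r t. if t = s then y $ r else 0)" for s y
  have "linear (L s)" for s
    by (rule linearI) (auto simp: L_def vec_eq_iff)
  then have L: "bounded_linear (L s)" for s
    by (rule linear_conv_bounded_linear[THEN iffD1])
  have "jacobian q (at x) = (\<Sum>s\<in>UNIV. L s (q' s x))" for x
    unfolding jacobian_def frechet_derivative_at[OF der, symmetric]
    by (simp add: vec_eq_iff forall_3 sum_3 matrix_def L_def axis_def)
  then show ?thesis
    by (simp only:) (intro poly_space_sum poly_space_bounded_linear[OF q' L])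
qed

section \<open>The derivative of the null Lagrangians\<close>

text \<open>Writing \<open>cof\<close> and \<open>det\<close> through one bilinear map makes \<open>D\<Phi>(F)J\<close> visibly linear in \<open>J\<close> and of degree
  0, 1 and 2 in \<open>F\<close>; these are the degrees for which \<^const>\<open>H_space\<close> contains \<open>D\<Phi>(F)\<nabla>v\<close>.\<close>

definition cof_polar :: "mat3 \<Rightarrow> mat3 \<Rightarrow> mat3" where
  "cof_polar E F = (\<chi> i \<alpha>. 1/2 * (\<Sum>j\<in>UNIV. \<Sum>k\<in>UNIV. \<Sum>\<beta>\<in>UNIV. \<Sum>\<gamma>\<in>UNIV.
      levi_civita i j k * levi_civita \<alpha> \<beta> \<gamma> * E $ j $ \<beta> * F $ k $ \<gamma>))"

lemma bounded_bilinear_cof_polar: "bounded_bilinear cof_polar"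
  unfolding bilinear_conv_bounded_bilinear[symmetric] bilinear_def
  by (intro conjI allI linearI)
    (simp_all add: cof_polar_def vec_eq_iff distrib_left distrib_right sum.distrib sum_distrib_left
      mult_ac)

text \<open>Cofactor expansion: F (cof F)^T = (det F) I, and the trace of both sides gives F
  \<bullet> cof F = 3 det F.\<close>

lemma det_eq_inner_cof_polar: "det F = (F \<bullet> cof_polar F F) / 3" for F :: mat3
  by (simp add: det_3 inner_vec_def cof_polar_def sum_3 levi_civita_def) (simp add: field_simps)

text \<open>The last entry is the raw product-rule derivative of
  \<open>(F \<bullet> cof_polar F F) / 3\<close>; by Jacobi's formula it equals cof F \<bullet>
  J.\<close>

definition DPhi :: "mat3 \<Rightarrow> mat3 \<Rightarrow> xi_space" where
  "DPhi F J = (J, cof_polar F J + cof_polar J F,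
     (F \<bullet> (cof_polar F J + cof_polar J F) + J \<bullet> cof_polar F F) / 3)"

lemma Phi_has_derivative: "(Phi has_derivative DPhi F) (at F)"
proof -
  interpret bounded_bilinear cof_polar by (rule bounded_bilinear_cof_polar)
  have "Phi = (\<lambda>F. (F, cof_polar F F, (F \<bullet> cof_polar F F) / 3))"
    by (simp add: fun_eq_iff Phi_def det_eq_inner_cof_polar cof_def cof_polar_def)
  moreover have "((\<lambda>F. (F, cof_polar F F, (F \<bullet> cof_polar F F) / 3)) has_derivative DPhi F) (at F)"
    unfolding DPhi_def[abs_def]
    by (auto intro!: derivative_eq_intros FDERIV)
  ultimately show ?thesis by simp
qed

lemma DPhi_grad_eq: "DPhi_grad F \<phi> x = DPhi (F x) (jacobian \<phi> (at x))"
  by (simp add: DPhi_grad_def frechet_derivative_at[OF Phi_has_derivative])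

section \<open>Piecewise polynomials on the torus\<close>

text \<open>Unlike L2, this class is stable under composition with arbitrary continuous maps such as
  \<open>G\<close> and \<open>grad G\<close>. Only integrals over the unit cell are at stake, so
  periodicity is left out.\<close>

definition Linf_torus :: "(real^3 \<Rightarrow> 'b::euclidean_space) set" where
  "Linf_torus = {f \<in> borel_measurable torus. \<exists>B. AE x in torus. norm (f x) \<le> B}"

lemma integrable_Linf_torus:
  assumes "f \<in> Linf_torus"
  shows "integrable torus f"
proof -
  interpret finite_measure torus
    unfolding torus_def by (rule finite_measure_lebesgue_on) simp
  show ?thesis
    using assms by (auto simp: Linf_torus_def intro: integrable_const_bound)
qed

lemma Linf_torus_Pair:
  assumes "f \<in> Linf_torus" "g \<in> Linf_torus"
  shows "(\<lambda>x. (f x, g x)) \<in> Linf_torus"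
proof -
  obtain B C where "AE x in torus. norm (f x) \<le> B" "AE x in torus. norm (g x) \<le> C"
    using assms by (auto simp: Linf_torus_def)
  then have "AE x in torus. norm (f x, g x) \<le> B + C"
    by eventually_elim (rule order_trans[OF norm_Pair_le], simp)
  moreover have "(\<lambda>x. (f x, g x)) \<in> borel_measurable torus"
    using assms by (intro borel_measurable_Pair) (auto simp: Linf_torus_def)
  ultimately show ?thesis by (auto simp: Linf_torus_def)
qed

text \<open>The essential range lies in a closed ball, which is compact in finite dimension, so its
  continuous image is bounded.\<close>

lemma Linf_torus_continuous:
  assumes "f \<in> Linf_torus" "continuous_on UNIV h"
  shows "(\<lambda>x. h (f x)) \<in> Linf_torus"
proof -
  obtain B where "AE x in torus. norm (f x) \<le> B"
    using assms(1) by (auto simp: Linf_torus_def)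
  moreover have "bounded (h ` cball 0 B)"
    by (intro compact_imp_bounded compact_continuous_image continuous_on_subset[OF assms(2)]) auto
  then obtain C where "\<And>y. norm y \<le> B \<Longrightarrow> norm (h y) \<le> C"
    unfolding bounded_iff by (metis image_eqI mem_cball_0)
  ultimately have "AE x in torus. norm (h (f x)) \<le> C"
    by auto
  moreover have "(\<lambda>x. h (f x)) \<in> borel_measurable torus"
    using assms by (auto simp: Linf_torus_def intro: measurable_compose borel_measurable_continuous_onI)
  ultimately show ?thesis by (auto simp: Linf_torus_def)
qed

lemma Linf_torus_continuous2:
  assumes "f \<in> Linf_torus" "g \<in> Linf_torus" "continuous_on UNIV (\<lambda>(y, z). h y z)"
  shows "(\<lambda>x. h (f x) (g x)) \<in> Linf_torus"
  using Linf_torus_continuous[OF Linf_torus_Pair[OF assms(1,2)] assms(3)] by simp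

lemma continuous_in_Linf_torus:
  assumes "continuous_on UNIV f"
  shows "f \<in> Linf_torus"
proof -
  have "bounded (f ` cbox 0 1)"
    by (intro compact_imp_bounded compact_continuous_image continuous_on_subset[OF assms]) auto
  then obtain B where "\<And>x. x \<in> cbox 0 1 \<Longrightarrow> norm (f x) \<le> B"
    by (auto simp: bounded_iff)
  then have "AE x in torus. norm (f x) \<le> B"
    by (auto simp: torus_def AE_restrict_space_iff)
  moreover have "f \<in> borel_measurable torus"
    unfolding torus_def
    by (intro continuous_imp_measurable_on_sets_lebesgue continuous_on_subset[OF assms]) auto
  ultimately show ?thesis by (auto simp: Linf_torus_def)
qed

section \<open>Essential boundedness of piecewise polynomials\<close>

lemma AE_lebesgue_on_iff:
  "K \<in> sets lebesgue \<Longrightarrow> (AE x in lebesgue_on K. P x) \<longleftrightarrow> (AE x in lebesgue. x \<in> K \<longrightarrow> P x)"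
  by (simp add: AE_restrict_space_iff)

lemma torus_triangulation_compact: "torus_triangulation \<T> \<Longrightarrow> K \<in> \<T> \<Longrightarrow> compact K"
  by (auto simp: torus_triangulation_def intro: compact_simplex)

lemma torus_triangulation_convex: "torus_triangulation \<T> \<Longrightarrow> K \<in> \<T> \<Longrightarrow> convex K"
  by (auto simp: torus_triangulation_def intro: convex_simplex)

lemma torus_triangulation_sets:
  "torus_triangulation \<T> \<Longrightarrow> K \<in> \<T> \<Longrightarrow> K \<in> sets lebesgue"
  by (meson torus_triangulation_compact lmeasurable_compact fmeasurableD)

text \<open>Finitely many elements meet the unit cell and together they cover it. On each of them
  \<open>f\<close> agrees almost everywhere with a polynomial, which is bounded on the compact
  element.\<close>

lemma piecewise_poly_Linf_torus:
  assumes \<T>: "torus_triangulation \<T>"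
    and f: "\<And>K. K \<in> \<T> \<Longrightarrow> \<exists>q\<in>poly_space m. AE x in lebesgue_on K. f x = q x"
  shows "f \<in> Linf_torus"
proof -
  define \<C> where "\<C> = {K \<in> \<T>. K \<inter> cbox 0 1 \<noteq> {}}"
  have "finite \<C>" "\<Union>\<T> = UNIV"
    using \<T> unfolding torus_triangulation_def \<C>_def by blast+
  then have \<C>: "finite \<C>" "cbox 0 1 \<subseteq> \<Union>\<C>" "\<And>K. K \<in> \<C> \<Longrightarrow> K \<in> \<T>"
    unfolding \<C>_def by blast+
  obtain q where q: "\<And>K. K \<in> \<T> \<Longrightarrow> q K \<in> poly_space m"
      "\<And>K. K \<in> \<T> \<Longrightarrow> AE x in lebesgue_on K. f x = q K x"
    using f by metis
  note sets = torus_triangulation_sets[OF \<T>]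
  have meas: "f \<in> borel_measurable (lebesgue_on K)" if K: "K \<in> \<T>" for K
  proof -
    have "q K \<in> borel_measurable (lebesgue_on K)"
      using continuous_imp_measurable_on_sets_lebesgue continuous_on_poly_space q(1) sets K by blast
    \<comment> \<open>Extension by zero moves the question to the whole space, where completeness of
      Lebesgue measure lets measurability pass from \<open>q K\<close> to the almost everywhere
      equal \<open>f\<close>.\<close>
    then have "(\<lambda>x. if x \<in> K then q K x else 0) \<in> borel_measurable lebesgue"
      using sets[OF K] by (simp add: borel_measurable_if)
    moreover have "AE x in lebesgue. (if x \<in> K then q K x else 0) = (if x \<in> K then f x else 0)"
      using q(2)[OF K] unfolding AE_lebesgue_on_iff[OF sets[OF K]] by eventually_elim auto
    ultimately have "(\<lambda>x. if x \<in> K then f x else 0) \<in> borel_measurable lebesgue"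
      by (rule borel_measurable_AE)
    then show ?thesis
      using sets[OF K] by (simp add: borel_measurable_if)
  qed
  have "f \<in> borel_measurable torus"
  proof (rule measurable_piecewise_restrict)
    show "countable \<C>" using \<C>(1) by (rule countable_finite)
    show "space torus \<subseteq> \<Union>\<C>" using \<C>(2) by (simp add: torus_def)
    fix K assume "K \<in> \<C>"
    then have K: "K \<in> \<T>" by (rule \<C>(3))
    show "K \<inter> space torus \<in> sets torus"
      using sets[OF K] by (auto simp: torus_def sets_restrict_space)
    have "f \<in> borel_measurable (restrict_space (lebesgue_on K) (cbox 0 1))"
      using meas[OF K] by (rule measurable_restrict_space1)
    then show "f \<in> borel_measurable (restrict_space torus K)"
      using sets[OF K] by (simp add: torus_def restrict_restrict_space Int_commute)
  qed
  moreover have "\<exists>B. AE x in torus. norm (f x) \<le> B"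
  proof -
    have "\<exists>B. \<forall>x\<in>K. norm (q K x) \<le> B" if "K \<in> \<C>" for K
    proof -
      have "compact (q K ` K)"
        using that by (intro compact_continuous_image continuous_on_poly_space[OF q(1)] \<C>(3)
            torus_triangulation_compact[OF \<T>])
      then show ?thesis
        by (auto dest!: compact_imp_bounded simp: bounded_iff)
    qed
    then obtain B where B: "\<And>K x. K \<in> \<C> \<Longrightarrow> x \<in> K \<Longrightarrow> norm (q K x) \<le> B K"
      by metis
    \<comment> \<open>A finite union of null sets is null, so one exceptional set serves all
      elements at once.\<close>
    have "AE x in lebesgue. \<forall>K\<in>\<C>. x \<in> K \<longrightarrow> f x = q K x"
    proof (rule AE_finite_allI[OF \<C>(1)])
      fix K assume "K \<in> \<C>"
      then have K: "K \<in> \<T>" by (rule \<C>(3))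
      show "AE x in lebesgue. x \<in> K \<longrightarrow> f x = q K x"
        using q(2)[OF K] unfolding AE_lebesgue_on_iff[OF sets[OF K]] .
    qed
    then have "AE x in lebesgue. x \<in> cbox 0 1 \<longrightarrow> norm (f x) \<le> Max (B ` \<C>)"
    proof eventually_elim
      case (elim x)
      show ?case
      proof
        assume "x \<in> cbox 0 1"
        then obtain K where K: "K \<in> \<C>" "x \<in> K" using \<C>(2) by blast
        then have "norm (f x) \<le> B K" using elim B by simp
        also have "\<dots> \<le> Max (B ` \<C>)" using \<C>(1) K(1) by simp
        finally show "norm (f x) \<le> Max (B ` \<C>)" .
      qed
    qed
    then have "AE x in torus. norm (f x) \<le> Max (B ` \<C>)"
      unfolding torus_def by (subst AE_lebesgue_on_iff) simp_all
    then show ?thesis ..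
  qed
  ultimately show ?thesis by (simp add: Linf_torus_def)
qed

text \<open>Square integrability over the unit cell follows from essential boundedness. Closure
  properties then reduce to periodicity and to polynomials on single elements.\<close>

lemma dg_space_eq:
  fixes \<T> :: "(real^3) set set"
  assumes "torus_triangulation \<T>"
  shows "dg_space \<T> m = {f. periodic f \<and> (\<forall>K\<in>\<T>. \<exists>q\<in>poly_space m. AE x in lebesgue_on K. f x = q x)}"
proof -
  have "f \<in> L2_space"
    if "periodic f" "\<And>K. K \<in> \<T> \<Longrightarrow> \<exists>q\<in>poly_space m. AE x in lebesgue_on K. f x = q x"
    for f :: "real^3 \<Rightarrow> 'a"
  proof -
    have f: "f \<in> Linf_torus"
      using piecewise_poly_Linf_torus[OF assms] that(2) by blast
    then have "(\<lambda>x. (norm (f x))\<^sup>2) \<in> Linf_torus"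
      by (rule Linf_torus_continuous) (intro continuous_intros)
    with f that(1) show ?thesis
      by (simp add: L2_space_def integrable_Linf_torus) (simp add: Linf_torus_def)
  qed
  then show ?thesis by (auto simp: dg_space_def L2_space_def)
qed

lemma dg_space_Linf_torus:
  assumes "torus_triangulation \<T>" "f \<in> dg_space \<T> m"
  shows "f \<in> Linf_torus"
  using assms(2) piecewise_poly_Linf_torus[OF assms(1)] by (auto simp: dg_space_def)

section \<open>Algebra of the discontinuous piecewise polynomial spaces\<close>

context
  fixes \<T> :: "(real^3) set set"
  assumes \<T>: "torus_triangulation \<T>"
begin

lemma dg_space_add:
  assumes "f \<in> dg_space \<T> m" "g \<in> dg_space \<T> m"
  shows "(\<lambda>x. f x + g x) \<in> dg_space \<T> m"
  unfolding dg_space_eq[OF \<T>]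
proof (intro CollectI conjI ballI)
  show "periodic (\<lambda>x. f x + g x)"
    using assms unfolding dg_space_eq[OF \<T>] by (simp add: periodic_def)
  fix K assume "K \<in> \<T>"
  then obtain p q where "p \<in> poly_space m" "q \<in> poly_space m"
    and "AE x in lebesgue_on K. f x = p x" "AE x in lebesgue_on K. g x = q x"
    using assms unfolding dg_space_eq[OF \<T>] by blast
  then show "\<exists>q\<in>poly_space m. AE x in lebesgue_on K. f x + g x = q x"
    by (intro bexI[where x = "\<lambda>x. p x + q x"] poly_space_add) auto
qed

lemma dg_space_bounded_linear:
  assumes "f \<in> dg_space \<T> m" "bounded_linear L"
  shows "(\<lambda>x. L (f x)) \<in> dg_space \<T> m"
  unfolding dg_space_eq[OF \<T>]
proof (intro CollectI conjI ballI)
  show "periodic (\<lambda>x. L (f x))"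
    using assms unfolding dg_space_eq[OF \<T>] by (simp add: periodic_def)
  fix K assume "K \<in> \<T>"
  then obtain p where "p \<in> poly_space m" "AE x in lebesgue_on K. f x = p x"
    using assms unfolding dg_space_eq[OF \<T>] by blast
  then show "\<exists>q\<in>poly_space m. AE x in lebesgue_on K. L (f x) = q x"
    by (intro bexI[OF _ poly_space_bounded_linear[OF _ assms(2)]]) auto
qed

lemma dg_space_bounded_bilinear:
  assumes "f \<in> dg_space \<T> m" "g \<in> dg_space \<T> n" "bounded_bilinear b"
  shows "(\<lambda>x. b (f x) (g x)) \<in> dg_space \<T> (m + n)"
  unfolding dg_space_eq[OF \<T>]
proof (intro CollectI conjI ballI)
  show "periodic (\<lambda>x. b (f x) (g x))"
    using assms unfolding dg_space_eq[OF \<T>] by (simp add: periodic_def)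
  fix K assume "K \<in> \<T>"
  then obtain p q where "p \<in> poly_space m" "q \<in> poly_space n"
    and "AE x in lebesgue_on K. f x = p x" "AE x in lebesgue_on K. g x = q x"
    using assms unfolding dg_space_eq[OF \<T>] by blast
  then show "\<exists>q\<in>poly_space (m + n). AE x in lebesgue_on K. b (f x) (g x) = q x"
    by (intro bexI[OF _ poly_space_bounded_bilinear[OF _ _ assms(3)]]) auto
qed

lemma dg_space_diff:
  assumes "f \<in> dg_space \<T> m" "g \<in> dg_space \<T> m"
  shows "(\<lambda>x. f x - g x) \<in> dg_space \<T> m"
  using dg_space_add[OF assms(1) dg_space_bounded_linear[OF assms(2), of uminus]]
  by (simp add: bounded_linear_minus bounded_linear_ident)

text \<open>Functions in \<^const>\<open>U_space\<close> need not be differentiable on the faces, but these are null sets.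
  Periodicity of the gradient has to hold at every point, so it also concerns the junk value of
  \<^const>\<open>frechet_derivative\<close> on the faces.\<close>

lemma jacobian_dg_space:
  assumes "\<phi> \<in> U_space \<T> k"
  shows "(\<lambda>x. jacobian \<phi> (at x)) \<in> dg_space \<T> (k - 1)"
  unfolding dg_space_eq[OF \<T>]
proof (intro CollectI conjI ballI)
  have per: "periodic \<phi>"
    using assms by (simp add: U_space_def)
  have shift: "(\<phi> has_derivative D) (at x)"
    if "a \<in> int_lattice" "(\<phi> has_derivative D) (at (x + a))" for a x D
  proof -
    have "((\<lambda>y. y + a) has_derivative (\<lambda>h. h)) (at x)"
      by (auto intro!: derivative_eq_intros)
    then have "((\<lambda>y. \<phi> (y + a)) has_derivative D) (at x)"
      using has_derivative_compose that(2) by fast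
    then show ?thesis
      using per that(1) by (simp add: periodic_def)
  qed
  have "(\<phi> has_derivative D) (at (x + a)) \<longleftrightarrow> (\<phi> has_derivative D) (at x)"
    if "a \<in> int_lattice" for a x D
    using shift[OF that, of D x] shift[of "- a" D "x + a"] that by (auto simp: int_lattice_def)
  \<comment> \<open>\<open>frechet_derivative\<close> chooses some \<open>D\<close> satisfying
    \<open>has_derivative\<close>. The predicates at \<open>x\<close> and \<open>x + a\<close>
    coincide, hence so do the choices, even where no derivative exists.\<close>
  then show "periodic (\<lambda>x. jacobian \<phi> (at x))"
    by (simp add: periodic_def jacobian_def frechet_derivative_def)
  fix K assume K: "K \<in> \<T>"
  then obtain q where q: "q \<in> poly_space k" "\<And>x. x \<in> K \<Longrightarrow> \<phi> x = q x"
    using assms by (auto simp: U_space_def)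
  \<comment> \<open>Agreement with \<open>q\<close> on an open neighbourhood determines the
    derivative. This fails on faces, where \<phi> may have a kink.\<close>
  have eq: "jacobian \<phi> (at x) = jacobian q (at x)" if "x \<in> interior K" for x
  proof -
    have "q differentiable at x"
      by (rule poly_space_has_derivative[OF q(1)]) (auto simp: differentiable_def)
    then have "frechet_derivative q (at x) = frechet_derivative \<phi> (at x)"
      by (rule frechet_derivative_transform_within_open[OF _ open_interior that])
        (use q(2) interior_subset in force)
    then show ?thesis by (simp add: jacobian_def)
  qed
  \<comment> \<open>The part of \<open>K\<close> outside its interior lies in the frontier, a null
    set because \<open>K\<close> is convex.\<close>
  have "negligible (frontier K)"
    by (intro negligible_convex_frontier torus_triangulation_convex[OF \<T> K])
  then have "AE x in lebesgue. x \<notin> frontier K"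
    by (simp add: negligible_iff_null_sets AE_not_in)
  then have "AE x in lebesgue_on K. jacobian \<phi> (at x) = jacobian q (at x)"
    unfolding AE_lebesgue_on_iff[OF torus_triangulation_sets[OF \<T> K]]
    by eventually_elim (use eq closure_subset[of K] in \<open>auto simp: frontier_def\<close>)
  then show "\<exists>p\<in>poly_space (k - 1). AE x in lebesgue_on K. jacobian \<phi> (at x) = p x"
    by (rule bexI[OF _ jacobian_poly_space[OF q(1)]])
qed

end

section \<open>Convexity of the stored energy\<close>

lemma frechet_derivative_eq_grad:
  assumes "f differentiable (at x)"
  shows "frechet_derivative f (at x) z = grad f x \<bullet> z"
proof -
  interpret linear "frechet_derivative f (at x)"
    using assms by (rule linear_frechet_derivative)
  have "frechet_derivative f (at x) z = frechet_derivative f (at x) (\<Sum>b\<in>Basis. (z \<bullet> b) *\<^sub>R b)"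
    by (simp add: euclidean_representation)
  also have "\<dots> = grad f x \<bullet> z"
    by (simp add: sum scale grad_def dderiv_def inner_sum_right inner_commute[of _ z] mult.commute)
  finally show ?thesis .
qed

lemma has_real_derivative_along_line:
  assumes "\<And>x. f differentiable (at x)"
  shows "((\<lambda>t. f (x + t *\<^sub>R z)) has_real_derivative grad f (x + t *\<^sub>R z) \<bullet> z) (at t)"
proof -
  have "(f has_derivative frechet_derivative f (at (x + t *\<^sub>R z))) (at (x + t *\<^sub>R z))"
    using assms frechet_derivative_works by blast
  then have "((\<lambda>t. f (x + t *\<^sub>R z)) has_derivative
      (\<lambda>h. frechet_derivative f (at (x + t *\<^sub>R z)) (h *\<^sub>R z))) (at t)"
    by (rule has_derivative_compose[rotated]) (auto intro!: derivative_eq_intros)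
  then show ?thesis
    by (rule has_derivative_imp_has_field_derivative)
      (simp add: frechet_derivative_eq_grad assms)
qed

text \<open>Along the segment from \<open>x\<close> to \<open>y\<close> the slope of
  \<open>f\<close> has derivative \<open>hess_form\<close>, so it is nondecreasing. By the mean
  value theorem f y - f x is the slope at an intermediate point, hence at least the slope at
  \<open>x\<close>.\<close>

lemma convex_gradient_inequality:
  assumes diff: "\<And>x. f differentiable (at x)" "\<And>b x. dderiv f b differentiable (at x)"
    and hess: "\<And>x z. 0 \<le> hess_form f x z"
  shows "f x + grad f x \<bullet> (y - x) \<le> f y"
proof -
  define z where "z = y - x"
  have grad_inner: "grad f p \<bullet> z = (\<Sum>a\<in>Basis. dderiv f a p * (z \<bullet> a))" for p
    by (simp add: grad_def inner_sum_right inner_commute[of _ z])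
  have "((\<lambda>t. grad f (x + t *\<^sub>R z) \<bullet> z) has_real_derivative
      (\<Sum>a\<in>Basis. (grad (dderiv f a) (x + t *\<^sub>R z) \<bullet> z) * (z \<bullet> a))) (at t)" for t
    unfolding grad_inner[of "x + _ *\<^sub>R z"]
    by (intro DERIV_sum DERIV_cmult_right has_real_derivative_along_line diff)
  moreover have "(\<Sum>a\<in>Basis. (grad (dderiv f a) p \<bullet> z) * (z \<bullet> a)) = hess_form f p z" for p
    by (simp add: hess_form_def grad_def inner_sum_right sum_distrib_left sum_distrib_right
        inner_commute[of _ z] mult_ac)
  ultimately have "((\<lambda>t. grad f (x + t *\<^sub>R z) \<bullet> z) has_real_derivative hess_form f (x + t *\<^sub>R z) z) (at t)" for t
    by simp
  then have mono: "grad f x \<bullet> z \<le> grad f (x + t *\<^sub>R z) \<bullet> z" if "0 \<le> t" for t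
    using DERIV_nonneg_imp_nondecreasing[OF that, of "\<lambda>t. grad f (x + t *\<^sub>R z) \<bullet> z"] hess by auto
  obtain s where "0 < s" "f (x + 1 *\<^sub>R z) - f (x + 0 *\<^sub>R z) = (1 - 0) * (grad f (x + s *\<^sub>R z) \<bullet> z)"
    using MVT2[of 0 1 "\<lambda>t. f (x + t *\<^sub>R z)" "\<lambda>t. grad f (x + t *\<^sub>R z) \<bullet> z"]
      has_real_derivative_along_line[OF diff(1)] by auto
  with mono[of s] show ?thesis
    by (simp add: z_def)
qed

lemma Ck_Suc_differentiable: "Ck (Suc n) f \<Longrightarrow> f differentiable (at x)"
  and Ck_dderiv: "Ck (Suc n) f \<Longrightarrow> Ck n (dderiv f b)"
  by auto

lemma Ck_Suc_continuous: "Ck (Suc n) f \<Longrightarrow> continuous_on UNIV f"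
  by (intro differentiable_imp_continuous_on differentiable_at_imp_differentiable_on Ck_Suc_differentiable)

lemma admissible_energy_gradient_inequality:
  assumes "admissible_energy G"
  shows "G \<xi> + grad G \<xi> \<bullet> (\<eta> - \<xi>) \<le> G \<eta>"
proof (rule convex_gradient_inequality)
  have G: "Ck (Suc (Suc (Suc 0))) G" and "uniformly_convex G"
    using assms by (simp_all add: admissible_energy_def flip: numeral_3_eq_3)
  show "G differentiable (at x)" for x
    using G by (rule Ck_Suc_differentiable)
  show "dderiv G b differentiable (at x)" for b x
    by (rule Ck_Suc_differentiable[OF Ck_dderiv[OF G]])
  obtain \<theta> where \<theta>: "\<theta> > 0" "\<And>x z. \<theta> * (norm z)\<^sup>2 \<le> hess_form G x z"
    using \<open>uniformly_convex G\<close> by (auto simp: uniformly_convex_def)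
  show "0 \<le> hess_form G x z" for x z
    by (rule order_trans[OF _ \<theta>(2)]) (use \<theta>(1) in simp)
qed

lemma admissible_energy_continuous:
  assumes "admissible_energy G"
  shows "continuous_on UNIV G" "continuous_on UNIV (grad G)"
proof -
  have G: "Ck (Suc (Suc (Suc 0))) G"
    using assms by (simp add: admissible_energy_def flip: numeral_3_eq_3)
  then show "continuous_on UNIV G" by (rule Ck_Suc_continuous)
  have "continuous_on UNIV (dderiv G b)" for b
    by (rule Ck_Suc_continuous[OF Ck_dderiv[OF G]])
  then show "continuous_on UNIV (grad G)"
    unfolding grad_def[abs_def] by (intro continuous_intros)
qed

section \<open>Energy dissipation\<close>

lemma H_spaceI:
  assumes "F \<in> HF_space \<T> k" "Z \<in> HZ_space \<T> k" "w \<in> Hw_space \<T> k"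
  shows "(\<lambda>x. (F x, Z x, w x)) \<in> H_space \<T> k"
  using assms unfolding H_space_def by blast

text \<open>Degree count with n = k - 1: \<open>F\<close> and the Jacobian of \<open>v\<close> have
  degree n, and the components of \<open>DPhi\<close> multiply one, two or three such factors,
  giving n, 2n and 3n.\<close>

lemma DPhi_grad_H_space:
  assumes \<T>: "torus_triangulation \<T>" and F: "F \<in> HF_space \<T> k" and v: "v \<in> U_space \<T> k"
  shows "DPhi_grad F v \<in> H_space \<T> k"
proof -
  define J where "J x = jacobian v (at x)" for x
  define n where "n = k - 1"
  have F: "F \<in> dg_space \<T> n" and J: "J \<in> dg_space \<T> n"
    using F jacobian_dg_space[OF \<T> v] by (auto simp: HF_space_def J_def[abs_def] n_def)
  note bil = dg_space_bounded_bilinear[OF \<T>] and add = dg_space_add[OF \<T>]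
  note cof = bil[OF _ _ bounded_bilinear_cof_polar] and inner = bil[OF _ _ bounded_bilinear_inner]
  have Z: "(\<lambda>x. cof_polar (F x) (J x) + cof_polar (J x) (F x)) \<in> dg_space \<T> (n + n)"
    by (intro add cof F J)
  have "(\<lambda>x. F x \<bullet> (cof_polar (F x) (J x) + cof_polar (J x) (F x)) + J x \<bullet> cof_polar (F x) (F x))
      \<in> dg_space \<T> (n + (n + n))"
    by (intro add inner[OF F Z] inner[OF J cof[OF F F]])
  then have w: "(\<lambda>x. (F x \<bullet> (cof_polar (F x) (J x) + cof_polar (J x) (F x)) + J x \<bullet> cof_polar (F x) (F x)) / 3)
      \<in> dg_space \<T> (n + (n + n))"
    by (rule dg_space_bounded_linear[OF \<T> _ bounded_linear_divide])
  have "(\<lambda>x. DPhi (F x) (J x)) \<in> H_space \<T> k"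
    unfolding DPhi_def using J Z w
    by (intro H_spaceI) (simp_all add: HF_space_def HZ_space_def Hw_space_def n_def mult_2 numeral_3_eq_3)
  then show ?thesis
    by (simp add: DPhi_grad_eq[abs_def] J_def)
qed

text \<open>Together with \<open>H_space_scaleR\<close> this makes the residual of the second
  equation an admissible test function.\<close>

lemma H_space_diff:
  assumes \<T>: "torus_triangulation \<T>" and "\<xi> \<in> H_space \<T> k" "\<eta> \<in> H_space \<T> k"
  shows "(\<lambda>x. \<xi> x - \<eta> x) \<in> H_space \<T> k"
proof -
  obtain F Z w F' Z' w' where "\<xi> = (\<lambda>x. (F x, Z x, w x))" "\<eta> = (\<lambda>x. (F' x, Z' x, w' x))"
    and "F \<in> HF_space \<T> k" "Z \<in> HZ_space \<T> k" "w \<in> Hw_space \<T> k"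
      "F' \<in> HF_space \<T> k" "Z' \<in> HZ_space \<T> k" "w' \<in> Hw_space \<T> k"
    using assms(2,3) by (auto simp: H_space_def)
  moreover from this have "(\<lambda>x. F x - F' x) \<in> HF_space \<T> k" "(\<lambda>x. Z x - Z' x) \<in> HZ_space \<T> k"
    "(\<lambda>x. w x - w' x) \<in> Hw_space \<T> k"
    unfolding HF_space_def HZ_space_def Hw_space_def by (auto intro: dg_space_diff[OF \<T>])
  ultimately show ?thesis
    by (simp add: H_spaceI)
qed

lemma H_space_scaleR:
  assumes \<T>: "torus_triangulation \<T>" and "\<xi> \<in> H_space \<T> k"
  shows "(\<lambda>x. c *\<^sub>R \<xi> x) \<in> H_space \<T> k"
proof -
  obtain F Z w where "\<xi> = (\<lambda>x. (F x, Z x, w x))"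
    and "F \<in> HF_space \<T> k" "Z \<in> HZ_space \<T> k" "w \<in> Hw_space \<T> k"
    using assms(2) by (auto simp: H_space_def)
  moreover from this have "(\<lambda>x. c *\<^sub>R F x) \<in> HF_space \<T> k" "(\<lambda>x. c *\<^sub>R Z x) \<in> HZ_space \<T> k"
    "(\<lambda>x. c *\<^sub>R w x) \<in> Hw_space \<T> k"
    unfolding HF_space_def HZ_space_def Hw_space_def
    by (auto intro!: dg_space_bounded_linear[OF \<T> _ bounded_linear_scaleR_right] simp del: real_scaleR_def)
  ultimately show ?thesis
    by (simp add: H_spaceI)
qed

lemma H_space_Linf_torus:
  assumes "torus_triangulation \<T>" "\<xi> \<in> H_space \<T> k"
  shows "\<xi> \<in> Linf_torus"
proof -
  obtain F Z w where "\<xi> = (\<lambda>x. (F x, Z x, w x))"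
    and "F \<in> HF_space \<T> k" "Z \<in> HZ_space \<T> k" "w \<in> Hw_space \<T> k"
    using assms(2) by (auto simp: H_space_def)
  then show ?thesis
    unfolding HF_space_def HZ_space_def Hw_space_def
    by (simp add: Linf_torus_Pair dg_space_Linf_torus[OF assms(1)])
qed

lemma fst_H_space: "\<xi> \<in> H_space \<T> k \<Longrightarrow> (\<lambda>x. fst (\<xi> x)) \<in> HF_space \<T> k"
  by (auto simp: H_space_def)

lemma Linf_torus_inner: "f \<in> Linf_torus \<Longrightarrow> g \<in> Linf_torus \<Longrightarrow> (\<lambda>x. f x \<bullet> g x) \<in> Linf_torus"
  by (rule Linf_torus_continuous2) (auto simp: case_prod_unfold intro!: continuous_intros)

lemma L2_norm_squared: "(L2_norm f)\<^sup>2 = (\<integral>x. f x \<bullet> f x \<partial>torus)"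
  by (simp add: L2_norm_def L2_inner_def)

text \<open>Expand the square of a = b - (b - a). With \<open>b\<close> the new and \<open>a\<close>
  the old velocity, the middle term is the numerical dissipation of the implicit step.\<close>

lemma inner_diff_self_right:
  "(b - a) \<bullet> b = 1/2 * (b \<bullet> b) + 1/2 * ((b - a) \<bullet> (b - a)) - 1/2 * (a \<bullet> a)"
  by (simp add: inner_diff_left inner_diff_right inner_commute[of b a] add_divide_distrib diff_divide_distrib)

theorem mainTheorem1:
  fixes G :: "xi_space \<Rightarrow> real" and \<T> :: "(real^3) set set" and k :: nat and \<tau> :: real
    and v0 v1 :: "real^3 \<Rightarrow> real^3" and \<xi>0 \<xi>1 :: "real^3 \<Rightarrow> xi_space"
  assumes "admissible_energy G"
    and "torus_triangulation \<T>"
    and "1 \<le> k"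
    and "0 < \<tau>"
    and "v0 \<in> U_space \<T> k" and "\<xi>0 \<in> H_space \<T> k"
    and "v1 \<in> U_space \<T> k" and "\<xi>1 \<in> H_space \<T> k"
    and "solves_scheme G \<T> k \<tau> v0 \<xi>0 v1 \<xi>1"
  shows "1/2 * (L2_norm v1)\<^sup>2 + 1/2 * (L2_norm (\<lambda>x. v1 x - v0 x))\<^sup>2 + (\<integral>x. G (\<xi>1 x) \<partial>torus)
         \<le> 1/2 * (L2_norm v0)\<^sup>2 + (\<integral>x. G (\<xi>0 x) \<partial>torus)"
proof -
  note \<T> = assms(2)
  define D where "D = DPhi_grad (\<lambda>x. fst (\<xi>0 x)) v1"
  define d where "d x = (\<xi>1 x - \<xi>0 x) /\<^sub>R \<tau>" for x
  \<comment> \<open>The residual of the second equation, which is to vanish almost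
    everywhere.\<close>
  define \<psi> where "\<psi> x = d x - D x" for x
  have D_H: "D \<in> H_space \<T> k"
    unfolding D_def by (intro DPhi_grad_H_space \<T> fst_H_space assms)
  have d_H: "d \<in> H_space \<T> k"
    unfolding d_def[abs_def] by (intro H_space_scaleR H_space_diff \<T> assms)
  have \<psi>_H: "\<psi> \<in> H_space \<T> k"
    unfolding \<psi>_def[abs_def] by (intro H_space_diff \<T> d_H D_H)
  note H_Linf = H_space_Linf_torus[OF \<T>, where k = k]
  have v: "v0 \<in> Linf_torus" "v1 \<in> Linf_torus"
    using assms(5,7) by (auto simp: U_space_def intro: continuous_in_Linf_torus)
  have dv: "(\<lambda>x. v1 x - v0 x) \<in> Linf_torus"
    by (rule Linf_torus_continuous2[OF v(2,1)]) (auto simp: case_prod_unfold intro!: continuous_intros)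
  note int = integrable_Linf_torus[OF Linf_torus_inner]
  have G: "(\<lambda>x. G (\<xi> x)) \<in> Linf_torus" "(\<lambda>x. grad G (\<xi> x)) \<in> Linf_torus" if "\<xi> \<in> H_space \<T> k" for \<xi>
    using Linf_torus_continuous[OF H_Linf[OF that]] admissible_energy_continuous[OF assms(1)] by auto

  have "(\<integral>x. d x \<bullet> \<psi> x \<partial>torus) = (\<integral>x. D x \<bullet> \<psi> x \<partial>torus)"
    using assms(9) \<psi>_H by (simp add: solves_scheme_def L2_inner_def D_def d_def)
  \<comment> \<open>A non-integrable function has integral 0 by default, so subtracting the two
    integrals calls for integrability of both integrands.\<close>
  moreover have "integrable torus (\<lambda>x. d x \<bullet> \<psi> x)" "integrable torus (\<lambda>x. D x \<bullet> \<psi> x)"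
    by (intro int H_Linf d_H D_H \<psi>_H)+
  ultimately have "(\<integral>x. d x \<bullet> \<psi> x - D x \<bullet> \<psi> x \<partial>torus) = 0"
    by simp
  then have "(\<integral>x. \<psi> x \<bullet> \<psi> x \<partial>torus) = 0"
    by (simp add: \<psi>_def inner_diff_left)
  then have "AE x in torus. \<psi> x = 0"
    using integral_nonneg_eq_0_iff_AE[OF int[OF H_Linf[OF \<psi>_H] H_Linf[OF \<psi>_H]]] by simp
  then have "AE x in torus. grad G (\<xi>1 x) \<bullet> D x = grad G (\<xi>1 x) \<bullet> d x"
    by eventually_elim (simp add: \<psi>_def)
  then have "(\<integral>x. grad G (\<xi>1 x) \<bullet> D x \<partial>torus) = (\<integral>x. grad G (\<xi>1 x) \<bullet> d x \<partial>torus)"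
    by (intro integral_cong_AE borel_measurable_integrable
        int[OF G(2)[OF assms(8)] H_Linf[OF D_H]] int[OF G(2)[OF assms(8)] H_Linf[OF d_H]])
  \<comment> \<open>The first equation tested with \<phi> = \<open>v1\<close>. The same field
    \<open>D\<close> appears in both equations, since both evaluate D\<Phi> at the old
    \<open>\<xi>0\<close>.\<close>
  moreover have "(\<integral>x. ((v1 x - v0 x) /\<^sub>R \<tau>) \<bullet> v1 x \<partial>torus) = - (\<integral>x. grad G (\<xi>1 x) \<bullet> D x \<partial>torus)"
    using assms(7,9) by (simp add: solves_scheme_def L2_inner_def D_def)
  ultimately have "inverse \<tau> * (\<integral>x. (v1 x - v0 x) \<bullet> v1 x \<partial>torus)
      = inverse \<tau> * - (\<integral>x. grad G (\<xi>1 x) \<bullet> (\<xi>1 x - \<xi>0 x) \<partial>torus)"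
    by (simp add: d_def)
  then have power: "(\<integral>x. (v1 x - v0 x) \<bullet> v1 x \<partial>torus)
      = - (\<integral>x. grad G (\<xi>1 x) \<bullet> (\<xi>1 x - \<xi>0 x) \<partial>torus)"
    using assms(4) by (subst (asm) mult_cancel_left) simp

  have grad_int: "integrable torus (\<lambda>x. grad G (\<xi>1 x) \<bullet> (\<xi>1 x - \<xi>0 x))"
    by (rule int[OF G(2)[OF assms(8)] H_Linf[OF H_space_diff[OF \<T> assms(8,6)]]])
  have G_int: "integrable torus (\<lambda>x. G (\<xi>1 x))" "integrable torus (\<lambda>x. G (\<xi>0 x))"
    using integrable_Linf_torus[OF G(1)] assms(6,8) by auto
  \<comment> \<open>The tangent at the new state \<open>\<xi>1\<close> lies below \<open>G\<close>
    at \<open>\<xi>0\<close>. Evaluating DG implicitly, at \<open>\<xi>1\<close>, is what gives the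
    inequality its favourable direction.\<close>
  have "(\<integral>x. G (\<xi>1 x) - grad G (\<xi>1 x) \<bullet> (\<xi>1 x - \<xi>0 x) \<partial>torus) \<le> (\<integral>x. G (\<xi>0 x) \<partial>torus)"
  proof (rule integral_mono)
    fix x
    show "G (\<xi>1 x) - grad G (\<xi>1 x) \<bullet> (\<xi>1 x - \<xi>0 x) \<le> G (\<xi>0 x)"
      using admissible_energy_gradient_inequality[OF assms(1), of "\<xi>1 x" "\<xi>0 x"]
      by (simp add: inner_diff_right)
  qed (use grad_int G_int in auto)
  then have energy: "(\<integral>x. G (\<xi>1 x) \<partial>torus) - (\<integral>x. G (\<xi>0 x) \<partial>torus)
      \<le> (\<integral>x. grad G (\<xi>1 x) \<bullet> (\<xi>1 x - \<xi>0 x) \<partial>torus)"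
    using grad_int G_int by simp

  have "(\<integral>x. (v1 x - v0 x) \<bullet> v1 x \<partial>torus)
      = (\<integral>x. 1/2 * (v1 x \<bullet> v1 x) + 1/2 * ((v1 x - v0 x) \<bullet> (v1 x - v0 x)) - 1/2 * (v0 x \<bullet> v0 x) \<partial>torus)"
    by (intro Bochner_Integration.integral_cong refl inner_diff_self_right)
  also have "\<dots> = 1/2 * (L2_norm v1)\<^sup>2 + 1/2 * (L2_norm (\<lambda>x. v1 x - v0 x))\<^sup>2 - 1/2 * (L2_norm v0)\<^sup>2"
    using int[OF v(1) v(1)] int[OF v(2) v(2)] int[OF dv dv]
    by (simp add: L2_norm_squared)
  finally show ?thesis
    using power energy by simp
qed

end
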